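(* Let $L=\langle a,t \mid a^2,\ [t^{i}at^{-i},t^{j}at^{-j}],\ i,j\in\mathbb{Z}\rangle$ be the lamplighter group. Then $L$ contains dead-end elements of arbitrary depth with respect to the generating set $\{t,ta\}$; that is, for every positive integer $N$ there is an element $w\in L$ which is a dead-end element with respect to $\{t,ta\}$ of depth at least $N$.
   Context: Let $G$ be a group with finite generating set $X$, and let $|g|$ denote the word length of $g\in G$ with respect to $X$ (the least $n$ such that $g$ is a product of $n$ elements of $X\cup X^{-1}$). An element $w\in G$ with $|w|=n$ is a dead-end element with respect to $X$ if $|wx|\le n$ for all $x\in X\cup X^{-1}$. A dead-end element $w$ with $|w|=n$ has depth $k$ with respect to $X$ if $k$ is the largest integer with the property that $|wx_1x_2\cdots x_l|\le n$ for all $1\le l\le k$ and all choices of $x_i\in X\cup X^{-1}$. *)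

theory Defs
  imports "HOL-Algebra.Generated_Groups"
begin

section \<open>Free groups\<close>

text \<open>The free group on a type of generators: words in signed letters, where \<^term>\<open>(x, True)\<close> stands
  for the generator \<open>x\<close> and \<^term>\<open>(x, False)\<close> for its formal inverse, modulo insertion and deletion
  of adjacent inverse pairs.\<close>

type_synonym 'x word = "('x \<times> bool) list"

inductive cancel_eq :: "'x word \<Rightarrow> 'x word \<Rightarrow> bool" where
  cancel: "cancel_eq (u @ [(x, e), (x, \<not> e)] @ v) (u @ v)"
| refl: "cancel_eq u u"
| sym: "cancel_eq u v \<Longrightarrow> cancel_eq v u"
| trans: "cancel_eq u v \<Longrightarrow> cancel_eq v w \<Longrightarrow> cancel_eq u w"

definition word_class :: "'x word \<Rightarrow> 'x word set" where
  "word_class u = {v. cancel_eq u v}"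

definition free_group :: "'x word set monoid" where
  "free_group =
     \<lparr>carrier = range word_class,
      monoid.mult = (\<lambda>A B. \<Union>u\<in>A. \<Union>v\<in>B. word_class (u @ v)),
      one = word_class []\<rparr>"

definition free_gen :: "'x \<Rightarrow> 'x word set" where
  "free_gen x = word_class [(x, True)]"

lemma cancel_eq_append:
  assumes "cancel_eq u u'" "cancel_eq v v'"
  shows "cancel_eq (u @ v) (u' @ v')"
proof -
  have "cancel_eq (u @ v) (u' @ v)"
    using assms(1)
  proof induction
    case (cancel p x e q)
    show ?case using cancel_eq.cancel[of p x e "q @ v"] by simp
  next
    case (trans p q r)
    show ?case by (rule cancel_eq.trans[OF trans.IH])
  qed (rule cancel_eq.refl, rule cancel_eq.sym)
  moreover have "cancel_eq (u' @ v) (u' @ v')"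
    using assms(2)
  proof induction
    case (cancel p x e q)
    show ?case using cancel_eq.cancel[of "u' @ p" x e q] by simp
  next
    case (trans p q r)
    show ?case by (rule cancel_eq.trans[OF trans.IH])
  qed (rule cancel_eq.refl, rule cancel_eq.sym)
  ultimately show ?thesis by (rule cancel_eq.trans)
qed

lemma word_class_eq_iff: "word_class u = word_class v \<longleftrightarrow> cancel_eq u v"
proof
  assume "word_class u = word_class v"
  then show "cancel_eq u v"
    using cancel_eq.refl[of v] by (metis word_class_def mem_Collect_eq)
next
  assume uv: "cancel_eq u v"
  have "cancel_eq u w \<longleftrightarrow> cancel_eq v w" for w
    using cancel_eq.trans[OF uv] cancel_eq.trans[OF cancel_eq.sym[OF uv]] by metis
  then show "word_class u = word_class v"
    by (simp add: word_class_def)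
qed

lemma free_group_carrier: "carrier free_group = range word_class"
  by (simp add: free_group_def)

lemma free_group_one: "\<one>\<^bsub>free_group\<^esub> = word_class []"
  by (simp add: free_group_def)

lemma free_group_mult: "word_class u \<otimes>\<^bsub>free_group\<^esub> word_class v = word_class (u @ v)"
proof -
  have "word_class (u' @ v') = word_class (u @ v)"
    if "u' \<in> word_class u" "v' \<in> word_class v" for u' v'
    using cancel_eq.sym[OF cancel_eq_append[of u u' v v']] that
    by (simp only: word_class_eq_iff) (simp add: word_class_def)
  then have "(\<Union>u'\<in>word_class u. \<Union>v'\<in>word_class v. word_class (u' @ v')) =
      (\<Union>u'\<in>word_class u. \<Union>v'\<in>word_class v. word_class (u @ v))"
    by (intro SUP_cong HOL.refl)
  moreover have "u \<in> word_class u" "v \<in> word_class v"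
    by (simp_all add: word_class_def cancel_eq.refl)
  then have "word_class u \<noteq> {}" "word_class v \<noteq> {}" by blast+
  ultimately show ?thesis
    by (simp add: free_group_def)
qed

lemma cancel_eq_inverse:
  "cancel_eq (rev (map (\<lambda>(x, e). (x, \<not> e)) w) @ w) []"
proof (induction w)
  case (Cons p w)
  obtain x e where p: "p = (x, e)" by force
  let ?r = "rev (map (\<lambda>(x, e). (x, \<not> e)) w)"
  have "cancel_eq (?r @ [(x, \<not> e), (x, \<not> \<not> e)] @ w) (?r @ w)"
    by (rule cancel_eq.cancel)
  from cancel_eq.trans[OF this Cons] show ?case by (simp add: p)
qed (simp add: cancel_eq.refl)

lemma free_group_is_group: "group (free_group :: 'x word set monoid)"
proof (rule groupI)
  fix A :: "'x word set"
  assume "A \<in> carrier free_group"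
  then obtain w where "A = word_class w" by (auto simp: free_group_carrier)
  moreover have "word_class (rev (map (\<lambda>(x, e). (x, \<not> e)) w) @ w) = word_class []"
    by (simp only: word_class_eq_iff cancel_eq_inverse)
  ultimately have "word_class (rev (map (\<lambda>(x, e). (x, \<not> e)) w)) \<otimes>\<^bsub>free_group\<^esub> A = \<one>\<^bsub>free_group\<^esub>"
    by (simp only: free_group_mult free_group_one)
  then show "\<exists>B\<in>carrier free_group. B \<otimes>\<^bsub>free_group\<^esub> A = \<one>\<^bsub>free_group\<^esub>"
    by (rule bexI) (simp add: free_group_carrier)
next
  fix A B :: "'x word set"
  assume A: "A \<in> carrier free_group" and B: "B \<in> carrier free_group"
  obtain u where u: "A = word_class u" using A unfolding free_group_carrier ..
  obtain v where v: "B = word_class v" using B unfolding free_group_carrier ..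
  show "A \<otimes>\<^bsub>free_group\<^esub> B \<in> carrier free_group"
    unfolding u v free_group_mult free_group_carrier by (rule rangeI)
  show "\<one>\<^bsub>free_group\<^esub> \<otimes>\<^bsub>free_group\<^esub> A = A"
    unfolding u free_group_mult free_group_one by simp
  fix C :: "'x word set"
  assume C: "C \<in> carrier free_group"
  obtain w where w: "C = word_class w" using C unfolding free_group_carrier ..
  show "A \<otimes>\<^bsub>free_group\<^esub> B \<otimes>\<^bsub>free_group\<^esub> C = A \<otimes>\<^bsub>free_group\<^esub> (B \<otimes>\<^bsub>free_group\<^esub> C)"
    unfolding u v w free_group_mult by simp
next
  show "\<one>\<^bsub>free_group\<^esub> \<in> carrier (free_group :: 'x word set monoid)"
    unfolding free_group_one free_group_carrier by (rule rangeI)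
qed

lemma free_gen_closed: "free_gen x \<in> carrier free_group"
  by (simp add: free_group_carrier free_gen_def)

lemma free_gen_inv: "inv\<^bsub>free_group\<^esub> (free_gen x) = word_class [(x, False)]"
proof -
  have "word_class ([(x, False)] @ [(x, True)]) = word_class []"
    using cancel_eq.cancel[of "[]" x False "[]"] by (simp add: word_class_eq_iff)
  then have "word_class [(x, False)] \<otimes>\<^bsub>free_group\<^esub> free_gen x = \<one>\<^bsub>free_group\<^esub>"
    by (simp only: free_gen_def free_group_mult free_group_one)
  then show ?thesis
    by (rule group.inv_equality[OF free_group_is_group _ free_gen_closed])
       (simp add: free_group_carrier)
qed

lemma free_group_generated: "generate free_group (range free_gen) = carrier free_group"
proof
  show "generate free_group (range free_gen) \<subseteq> carrier free_group"
    by (intro group.generate_incl[OF free_group_is_group]) (auto simp: free_gen_closed)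
next
  have "word_class w \<in> generate free_group (range free_gen)" for w :: "'x word"
  proof (induction w)
    case Nil
    show ?case using generate.one[of free_group] by (simp add: free_group_one)
  next
    case (Cons p w)
    obtain x e where p: "p = (x, e)" by force
    have "word_class [(x, e)] \<in> generate free_group (range free_gen)"
      using generate.incl[of "free_gen x" "range free_gen" free_group]
        generate.inv[of "free_gen x" "range free_gen" free_group]
      by (cases e) (auto simp: free_gen_inv, auto simp: free_gen_def)
    from generate.eng[OF this Cons] show ?case
      by (simp add: free_group_mult p)
  qed
  then show "carrier free_group \<subseteq> generate free_group (range free_gen)"
    by (auto simp: free_group_carrier)
qed


section \<open>Presentations\<close>

definition normal_closure :: "('a, 'b) monoid_scheme \<Rightarrow> 'a set \<Rightarrow> 'a set" where
  "normal_closure G R = \<Inter> {N. N \<lhd> G \<and> R \<subseteq> N}"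

definition presented_group :: "'x word set set \<Rightarrow> 'x word set set monoid" where
  "presented_group R = free_group Mod normal_closure free_group R"

definition presented_gen :: "'x word set set \<Rightarrow> 'x \<Rightarrow> 'x word set set" where
  "presented_gen R x = normal_closure free_group R #>\<^bsub>free_group\<^esub> free_gen x"

lemma (in group) normal_closure_normal:
  assumes "R \<subseteq> carrier G"
  shows "normal_closure G R \<lhd> G"
proof -
  have "carrier G \<lhd> G"
    unfolding normal_inv_iff using subgroup_self by auto
  then have ne: "{N. N \<lhd> G \<and> R \<subseteq> N} \<noteq> {}"
    using assms by blast
  show ?thesis
    unfolding normal_closure_def normal_inv_iff[of "\<Inter> {N. N \<lhd> G \<and> R \<subseteq> N}"]
  proof (intro conjI ballI)
    show "subgroup (\<Inter> {N. N \<lhd> G \<and> R \<subseteq> N}) G"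
      using ne by (intro subgroups_Inter) (auto simp: normal_inv_iff)
    show "x \<otimes> h \<otimes> inv x \<in> \<Inter> {N. N \<lhd> G \<and> R \<subseteq> N}"
      if "x \<in> carrier G" "h \<in> \<Inter> {N. N \<lhd> G \<and> R \<subseteq> N}" for x h
      using that by (auto simp: normal_inv_iff)
  qed
qed

lemma presented_group_is_group:
  assumes "R \<subseteq> carrier free_group"
  shows "group (presented_group R)"
  unfolding presented_group_def
  by (intro normal.factorgroup_is_group group.normal_closure_normal free_group_is_group assms)

lemma presented_group_proj_hom:
  assumes "R \<subseteq> carrier free_group"
  shows "(\<lambda>w. normal_closure free_group R #>\<^bsub>free_group\<^esub> w) \<in> hom free_group (presented_group R)"
  unfolding presented_group_def
  by (intro normal.r_coset_hom_Mod group.normal_closure_normal free_group_is_group assms)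

lemma presented_gen_closed:
  assumes "R \<subseteq> carrier free_group"
  shows "presented_gen R x \<in> carrier (presented_group R)"
  unfolding presented_gen_def
  by (rule hom_in_carrier[OF presented_group_proj_hom[OF assms] free_gen_closed])

lemma presented_group_generated:
  assumes "R \<subseteq> carrier free_group"
  shows "generate (presented_group R) (range (presented_gen R)) = carrier (presented_group R)"
proof -
  let ?p = "\<lambda>w. normal_closure free_group R #>\<^bsub>free_group\<^esub> w"
  interpret group_hom free_group "presented_group R" ?p
    using presented_group_proj_hom[OF assms] presented_group_is_group[OF assms] free_group_is_group
    by (simp add: group_hom_def group_hom_axioms_def)
  have "generate (presented_group R) (?p ` range free_gen) = ?p ` generate free_group (range free_gen)"
    by (rule generate_img) (simp add: image_subset_iff free_gen_closed)
  also have "\<dots> = carrier (presented_group R)"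
    by (simp add: free_group_generated presented_group_def carrier_FactGroup)
  finally show ?thesis
    by (simp add: presented_gen_def image_image)
qed


section \<open>Word length, dead ends, depth\<close>

definition sym_gens :: "('a, 'b) monoid_scheme \<Rightarrow> 'a set \<Rightarrow> 'a set" where
  "sym_gens G S = S \<union> (\<lambda>x. inv\<^bsub>G\<^esub> x) ` S"

definition list_prod :: "('a, 'b) monoid_scheme \<Rightarrow> 'a list \<Rightarrow> 'a" where
  "list_prod G xs = foldr (monoid.mult G) xs \<one>\<^bsub>G\<^esub>"

text \<open>The notions below are meant for a group \<open>G\<close> generated by the finite set \<open>S\<close>; the \<open>LEAST\<close> is
  unspecified for elements outside the subgroup generated by \<open>S\<close>.\<close>

definition word_length :: "('a, 'b) monoid_scheme \<Rightarrow> 'a set \<Rightarrow> 'a \<Rightarrow> nat" where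
  "word_length G S g =
     (LEAST n. \<exists>xs. length xs = n \<and> set xs \<subseteq> sym_gens G S \<and> list_prod G xs = g)"

definition dead_end :: "('a, 'b) monoid_scheme \<Rightarrow> 'a set \<Rightarrow> 'a \<Rightarrow> bool" where
  "dead_end G S w \<longleftrightarrow> w \<in> carrier G \<and>
     (\<forall>x\<in>sym_gens G S. word_length G S (w \<otimes>\<^bsub>G\<^esub> x) \<le> word_length G S w)"

text \<open>\<^term>\<open>no_escape G S w k\<close>: no product of between \<open>1\<close> and \<open>k\<close> generators leads from \<open>w\<close> out of the
  ball of radius \<open>word_length G S w\<close>. The depth is the largest such \<open>k\<close>; stating it as a relation
  means that an infinite depth is not assigned a number.\<close>

definition no_escape :: "('a, 'b) monoid_scheme \<Rightarrow> 'a set \<Rightarrow> 'a \<Rightarrow> nat \<Rightarrow> bool" where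
  "no_escape G S w k \<longleftrightarrow>
     (\<forall>xs. 1 \<le> length xs \<and> length xs \<le> k \<and> set xs \<subseteq> sym_gens G S \<longrightarrow>
        word_length G S (w \<otimes>\<^bsub>G\<^esub> list_prod G xs) \<le> word_length G S w)"

definition has_depth :: "('a, 'b) monoid_scheme \<Rightarrow> 'a set \<Rightarrow> 'a \<Rightarrow> nat \<Rightarrow> bool" where
  "has_depth G S w k \<longleftrightarrow> no_escape G S w k \<and> (\<forall>m. no_escape G S w m \<longrightarrow> m \<le> k)"


section \<open>The lamplighter group\<close>

datatype lamp_gen = A | T

definition group_commutator :: "('a, 'b) monoid_scheme \<Rightarrow> 'a \<Rightarrow> 'a \<Rightarrow> 'a" where
  "group_commutator G x y = x \<otimes>\<^bsub>G\<^esub> y \<otimes>\<^bsub>G\<^esub> inv\<^bsub>G\<^esub> x \<otimes>\<^bsub>G\<^esub> inv\<^bsub>G\<^esub> y"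

definition lamp_conj :: "int \<Rightarrow> lamp_gen word set" where
  "lamp_conj i =
     free_gen T [^]\<^bsub>free_group\<^esub> i \<otimes>\<^bsub>free_group\<^esub> free_gen A \<otimes>\<^bsub>free_group\<^esub> free_gen T [^]\<^bsub>free_group\<^esub> (- i)"

definition lamp_relators :: "lamp_gen word set set" where
  "lamp_relators =
     {free_gen A [^]\<^bsub>free_group\<^esub> (2::nat)} \<union>
     {group_commutator free_group (lamp_conj i) (lamp_conj j) | i j. True}"

definition lamplighter :: "lamp_gen word set set monoid" where
  "lamplighter = presented_group lamp_relators"

definition lamp_a :: "lamp_gen word set set" where
  "lamp_a = presented_gen lamp_relators A"

definition lamp_t :: "lamp_gen word set set" where
  "lamp_t = presented_gen lamp_relators T"

lemma lamp_relators_closed: "lamp_relators \<subseteq> carrier free_group"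
proof -
  interpret group "free_group :: lamp_gen word set monoid" by (rule free_group_is_group)
  show ?thesis
    by (auto simp: lamp_relators_def lamp_conj_def group_commutator_def free_gen_closed)
qed

lemma lamplighter_is_group: "group lamplighter"
  unfolding lamplighter_def by (rule presented_group_is_group[OF lamp_relators_closed])

lemma lamp_gens_closed: "lamp_a \<in> carrier lamplighter" "lamp_t \<in> carrier lamplighter"
  by (simp_all add: lamp_a_def lamp_t_def lamplighter_def presented_gen_closed[OF lamp_relators_closed])

lemma lamplighter_generated:
  "generate lamplighter {lamp_t, lamp_t \<otimes>\<^bsub>lamplighter\<^esub> lamp_a} = carrier lamplighter"
proof -
  interpret group lamplighter by (rule lamplighter_is_group)
  let ?X = "{lamp_t, lamp_t \<otimes>\<^bsub>lamplighter\<^esub> lamp_a}"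
  have X: "?X \<subseteq> carrier lamplighter" using lamp_gens_closed by simp
  have t: "lamp_t \<in> generate lamplighter ?X"
    and ta: "lamp_t \<otimes>\<^bsub>lamplighter\<^esub> lamp_a \<in> generate lamplighter ?X"
    by (auto intro: generate.incl)
  have "inv\<^bsub>lamplighter\<^esub> lamp_t \<otimes>\<^bsub>lamplighter\<^esub> (lamp_t \<otimes>\<^bsub>lamplighter\<^esub> lamp_a)
      \<in> generate lamplighter ?X"
    by (intro generate.eng ta generate_m_inv_closed X t)
  then have a: "lamp_a \<in> generate lamplighter ?X"
    using lamp_gens_closed by (simp add: m_assoc[symmetric])
  have "range (presented_gen lamp_relators) \<subseteq> generate lamplighter ?X"
  proof
    fix g assume "g \<in> range (presented_gen lamp_relators)"
    then obtain x where "g = presented_gen lamp_relators x" by auto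
    with a t show "g \<in> generate lamplighter ?X"
      by (cases x) (auto simp: lamp_a_def lamp_t_def)
  qed
  then have "generate lamplighter (range (presented_gen lamp_relators)) \<subseteq> generate lamplighter ?X"
    by (rule generate_subgroup_incl) (rule generate_is_subgroup[OF X])
  then show ?thesis
    using presented_group_generated[OF lamp_relators_closed] generate_incl[OF X]
    by (simp add: lamplighter_def)
qed

end

theory Submission
  imports Defs "HOL-Algebra.FiniteProduct"
begin

text \<open>An element of the lamplighter group is a finite set of lit lamps together with a position.
  Placing lamp \<open>j\<close> on the edge between \<open>j - 1\<close> and \<open>j\<close>, a letter from \<open>{t, ta}\<close> or an inverse of one
  crosses an edge and toggles the lamp on it or not, at will. So the length of an element is the least
  length of a walk from \<open>0\<close> to its position that crosses every lit edge. The element with lamps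
  \<open>1 - n\<close> and \<open>n\<close> lit and position \<open>0\<close> has length \<open>4n\<close>, while every element with all lamps in
  \<open>{1 - n..n}\<close> and position \<open>p\<close>, \<open>\<bar>p\<bar> \<le> n\<close>, has length at most \<open>4n - \<bar>p\<bar>\<close>; these include
  everything within distance \<open>n\<close> of that element.\<close>

section \<open>Word length in groups\<close>

lemma list_prod_Nil [simp]: "list_prod G [] = \<one>\<^bsub>G\<^esub>"
  and list_prod_Cons [simp]: "list_prod G (x # xs) = x \<otimes>\<^bsub>G\<^esub> list_prod G xs"
  by (simp_all add: list_prod_def)

lemma (in monoid) list_prod_closed [simp]:
  "set xs \<subseteq> carrier G \<Longrightarrow> list_prod G xs \<in> carrier G"
  by (induction xs) auto

lemma (in monoid) list_prod_append:
  "set xs \<subseteq> carrier G \<Longrightarrow> set ys \<subseteq> carrier G \<Longrightarrow>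
    list_prod G (xs @ ys) = list_prod G xs \<otimes> list_prod G ys"
  by (induction xs) (auto simp: m_assoc)

lemma (in group) sym_gens_closed: "S \<subseteq> carrier G \<Longrightarrow> sym_gens G S \<subseteq> carrier G"
  by (auto simp: sym_gens_def)

lemma (in group) generate_imp_list_prod:
  assumes "S \<subseteq> carrier G" "x \<in> generate G S"
  shows "\<exists>xs. set xs \<subseteq> sym_gens G S \<and> list_prod G xs = x"
  using assms(2)
proof induction
  case one
  show ?case by (rule exI[of _ "[]"]) simp
next
  case (incl h)
  then show ?case using assms(1) by (intro exI[of _ "[h]"]) (auto simp: sym_gens_def)
next
  case (inv h)
  then show ?case using assms(1) by (intro exI[of _ "[inv h]"]) (auto simp: sym_gens_def)
next
  case (eng h1 h2)
  then obtain xs ys where "set xs \<subseteq> sym_gens G S" "list_prod G xs = h1"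
    "set ys \<subseteq> sym_gens G S" "list_prod G ys = h2" by blast
  moreover from this sym_gens_closed[OF assms(1)]
  have "list_prod G (xs @ ys) = list_prod G xs \<otimes> list_prod G ys"
    by (intro list_prod_append) auto
  ultimately show ?case by (intro exI[of _ "xs @ ys"]) auto
qed

lemma no_escape_imp_dead_end:
  assumes "group G" "S \<subseteq> carrier G" "w \<in> carrier G" "no_escape G S w k" "k \<ge> 1"
  shows "dead_end G S w"
proof -
  interpret group G by fact
  have "word_length G S (w \<otimes>\<^bsub>G\<^esub> x) \<le> word_length G S w" if "x \<in> sym_gens G S" for x
  proof -
    have "x \<in> carrier G" using that sym_gens_closed[OF assms(2)] by auto
    then show ?thesis
      using assms(4,5) that unfolding no_escape_def by (auto dest: spec[of _ "[x]"])
  qed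
  then show ?thesis using assms(3) by (simp add: dead_end_def)
qed

text \<open>\<open>no_escape\<close> is downward closed in its last argument, so one failure bounds
  every value where it holds, and a greatest such value exists.\<close>

lemma has_depth_ge:
  assumes "no_escape G S w n" "\<not> no_escape G S w m"
  shows "\<exists>k\<ge>n. has_depth G S w k"
proof -
  have bound: "\<forall>k. no_escape G S w k \<longrightarrow> k \<le> m"
    using assms(2) unfolding no_escape_def by (meson le_trans nat_le_linear)
  define k where "k = (GREATEST k. no_escape G S w k)"
  have "no_escape G S w k" and "\<forall>l. no_escape G S w l \<longrightarrow> l \<le> k"
    using GreatestI_nat[of "no_escape G S w", OF assms(1)] Greatest_le_nat[of "no_escape G S w"] bound
    by (auto simp: k_def)
  with assms(1) show ?thesis by (auto simp: has_depth_def)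
qed

section \<open>Word length and depth under injective homomorphisms\<close>

context group_hom
begin

lemma hom_list_prod: "set xs \<subseteq> carrier G \<Longrightarrow> h (list_prod G xs) = list_prod H (map h xs)"
  by (induction xs) auto

lemma sym_gens_image: "S \<subseteq> carrier G \<Longrightarrow> sym_gens H (h ` S) = h ` sym_gens G S"
  by (auto simp: sym_gens_def image_Un image_image subset_iff cong: image_cong)

text \<open>A word over the image generators lifts letter by letter, and by injectivity it spells
  \<open>h g\<close> only if its lift spells \<open>g\<close>. So the two \<open>LEAST\<close>
  operators range over the same lengths, and lengths can be computed in a target larger than the
  image.\<close>

lemma word_length_inj_hom:
  assumes inj: "inj_on h (carrier G)" and S: "S \<subseteq> carrier G" and g: "g \<in> carrier G"
  shows "word_length H (h ` S) (h g) = word_length G S g"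
proof -
  have "(\<exists>ys. length ys = n \<and> set ys \<subseteq> sym_gens H (h ` S) \<and> list_prod H ys = h g) \<longleftrightarrow>
      (\<exists>xs. length xs = n \<and> set xs \<subseteq> sym_gens G S \<and> list_prod G xs = g)" for n
  proof
    assume "\<exists>ys. length ys = n \<and> set ys \<subseteq> sym_gens H (h ` S) \<and> list_prod H ys = h g"
    then obtain ys where ys: "length ys = n" "set ys \<subseteq> h ` sym_gens G S" "list_prod H ys = h g"
      using sym_gens_image[OF S] by auto
    from ys(2) have "ys \<in> lists (h ` sym_gens G S)" by (simp only: lists_eq_set mem_Collect_eq)
    then obtain xs where xs: "set xs \<subseteq> sym_gens G S" "ys = map h xs"
      unfolding lists_image by (auto simp: lists_eq_set)
    then have "set xs \<subseteq> carrier G" using G.sym_gens_closed[OF S] by auto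
    then have "list_prod G xs = g"
      using inj g ys(3) xs(2) by (auto simp: hom_list_prod inj_on_def)
    then show "\<exists>xs. length xs = n \<and> set xs \<subseteq> sym_gens G S \<and> list_prod G xs = g"
      using xs ys(1) by auto
  next
    assume "\<exists>xs. length xs = n \<and> set xs \<subseteq> sym_gens G S \<and> list_prod G xs = g"
    then obtain xs where xs: "length xs = n" "set xs \<subseteq> sym_gens G S" "list_prod G xs = g" by auto
    moreover have "set xs \<subseteq> carrier G" using xs(2) G.sym_gens_closed[OF S] by auto
    ultimately show "\<exists>ys. length ys = n \<and> set ys \<subseteq> sym_gens H (h ` S) \<and> list_prod H ys = h g"
      using sym_gens_image[OF S] by (intro exI[of _ "map h xs"]) (auto simp: hom_list_prod)
  qed
  then show ?thesis by (simp add: word_length_def)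
qed

lemma no_escape_inj_hom:
  assumes inj: "inj_on h (carrier G)" and S: "S \<subseteq> carrier G" and w: "w \<in> carrier G"
  shows "no_escape H (h ` S) (h w) k \<longleftrightarrow> no_escape G S w k"
proof -
  let ?P = "\<lambda>xs. word_length G S (w \<otimes> list_prod G xs) \<le> word_length G S w"
  let ?Q = "\<lambda>ys. word_length H (h ` S) (h w \<otimes>\<^bsub>H\<^esub> list_prod H ys) \<le> word_length H (h ` S) (h w)"
  have *: "?Q (map h xs) \<longleftrightarrow> ?P xs" if "set xs \<subseteq> sym_gens G S" for xs
  proof -
    have "set xs \<subseteq> carrier G" using that G.sym_gens_closed[OF S] by auto
    moreover from this have "h w \<otimes>\<^bsub>H\<^esub> list_prod H (map h xs) = h (w \<otimes> list_prod G xs)"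
      using w by (simp add: hom_list_prod)
    ultimately show ?thesis using w by (simp add: word_length_inj_hom[OF inj S] del: hom_mult)
  qed
  \<comment> \<open>Every admissible word of the target has the form \<open>map h xs\<close>, and
    for such words the two inequalities have just been shown equivalent.\<close>
  have "{ys. set ys \<subseteq> sym_gens H (h ` S)} = map h ` {xs. set xs \<subseteq> sym_gens G S}"
    unfolding sym_gens_image[OF S] using lists_image[of h "sym_gens G S"] by (simp add: lists_eq_set)
  moreover have "no_escape H (h ` S) (h w) k \<longleftrightarrow>
      (\<forall>ys\<in>{ys. set ys \<subseteq> sym_gens H (h ` S)}. 1 \<le> length ys \<and> length ys \<le> k \<longrightarrow> ?Q ys)"
    by (auto simp: no_escape_def)
  ultimately have "no_escape H (h ` S) (h w) k \<longleftrightarrow>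
      (\<forall>ys\<in>map h ` {xs. set xs \<subseteq> sym_gens G S}. 1 \<le> length ys \<and> length ys \<le> k \<longrightarrow> ?Q ys)"
    by simp
  also have "\<dots> \<longleftrightarrow> no_escape G S w k"
    using * unfolding no_escape_def by auto
  finally show ?thesis .
qed

end

section \<open>The universal property of a presentation\<close>

text \<open>Words are evaluated letter by letter. Adjacent inverse pairs evaluate to the identity,
  so the value depends only on the class.\<close>

lemma free_group_lift:
  fixes f :: "'x \<Rightarrow> 'b" and H (structure)
  assumes "group H" and f: "\<And>x. f x \<in> carrier H"
  shows "\<exists>h\<in>hom free_group H. \<forall>x. h (free_gen x) = f x"
proof -
  interpret H: group H by fact
  define letter where "letter = (\<lambda>(x, e). if e then f x else inv f x)"
  define ev where "ev w = list_prod H (map letter w)" for w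
  have letter: "range letter \<subseteq> carrier H" using f by (auto simp: letter_def)
  then have closed: "ev w \<in> carrier H" for w
    unfolding ev_def by (intro H.list_prod_closed) auto
  have append: "ev (u @ v) = ev u \<otimes> ev v" for u v
    unfolding ev_def map_append using letter by (intro H.list_prod_append) auto
  have pair: "ev [(x, e), (x, \<not> e)] = \<one>" for x e
    using f by (cases e) (simp_all add: ev_def letter_def)
  have cancel: "ev u = ev v" if "cancel_eq u v" for u v
    using that by induction (simp_all only: append pair closed H.l_one)
  \<comment> \<open>An arbitrary representative is evaluated; \<open>cancel\<close> makes the choice
    irrelevant.\<close>
  define h where "h X = ev (SOME w. w \<in> X)" for X
  have h: "h (word_class w) = ev w" for w
  proof -
    have "w \<in> word_class w" by (simp add: word_class_def cancel_eq.refl)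
    then have "(SOME v. v \<in> word_class w) \<in> word_class w" by (rule someI)
    then have "cancel_eq w (SOME v. v \<in> word_class w)" by (simp add: word_class_def)
    then show ?thesis by (simp add: h_def cancel)
  qed
  show ?thesis
  proof (intro bexI[of _ h] allI)
    show "h (free_gen x) = f x" for x
      using f by (simp add: free_gen_def h ev_def letter_def)
    show "h \<in> hom free_group H"
      by (auto simp: hom_def free_group_carrier free_group_mult h append closed)
  qed
qed

text \<open>The kernel of the lift from the free group is normal and contains \<open>R\<close>,
  hence the normal closure, so the lift factors through the quotient. \<open>relators\<close> speaks
  of every extension of \<open>f\<close> because the lift is only obtained from an existence
  statement.\<close>

lemma presented_group_lift:
  fixes f :: "'x \<Rightarrow> 'b"
  assumes "group H" and f: "\<And>x. f x \<in> carrier H" and R: "R \<subseteq> carrier free_group"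
    and relators: "\<And>h r. h \<in> hom free_group H \<Longrightarrow> (\<And>x. h (free_gen x) = f x) \<Longrightarrow> r \<in> R \<Longrightarrow>
      h r = \<one>\<^bsub>H\<^esub>"
  shows "\<exists>h\<in>hom (presented_group R) H. \<forall>x. h (presented_gen R x) = f x"
proof -
  obtain h where h: "h \<in> hom free_group H" "\<And>x. h (free_gen x) = f x"
    using free_group_lift[of H f, OF assms(1) f] by blast
  interpret group_hom "free_group :: 'x word set monoid" H h
    using h(1) assms(1) free_group_is_group by (simp add: group_hom_def group_hom_axioms_def)
  have "R \<subseteq> kernel free_group H h"
    using R relators[OF h] by (auto simp: kernel_def)
  then have "normal_closure free_group R \<subseteq> kernel free_group H h"
    using normal_kernel unfolding normal_closure_def by blast
  then obtain g where "g \<in> hom (presented_group R) H"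
    "\<And>x. x \<in> carrier free_group \<Longrightarrow> g (normal_closure free_group R #>\<^bsub>free_group\<^esub> x) = h x"
    using FactGroup_universal_kernel[OF G.normal_closure_normal[OF R]]
    unfolding presented_group_def by metis
  then show ?thesis
    using h(2) by (intro bexI[of _ g]) (auto simp: presented_gen_def free_gen_closed)
qed

lemma presented_relator_trivial:
  assumes R: "R \<subseteq> carrier free_group" and r: "r \<in> R"
  shows "normal_closure free_group R #>\<^bsub>free_group\<^esub> r = \<one>\<^bsub>presented_group R\<^esub>"
proof -
  interpret normal "normal_closure free_group R" free_group
    by (rule group.normal_closure_normal[OF free_group_is_group R])
  have "r \<in> normal_closure free_group R"
    using r by (auto simp: normal_closure_def)
  then show ?thesis
    by (simp add: presented_group_def FactGroup_def is_group is_subgroup group.coset_join2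
        subgroup.mem_carrier)
qed

section \<open>Lamp configurations\<close>

definition lamp_model :: "(int set \<times> int) monoid" where
  "lamp_model =
     \<lparr>carrier = UNIV,
      monoid.mult = (\<lambda>(S, p) (S', q). ({j. (j \<in> S) \<noteq> (j - p \<in> S')}, p + q)),
      one = ({}, 0)\<rparr>"

lemma lamp_model_carrier [simp]: "carrier lamp_model = UNIV"
  and lamp_model_one [simp]: "\<one>\<^bsub>lamp_model\<^esub> = ({}, 0)"
  and lamp_model_mult [simp]:
    "(S, p) \<otimes>\<^bsub>lamp_model\<^esub> (S', q) = ({j. (j \<in> S) \<noteq> (j - p \<in> S')}, p + q)"
  by (simp_all add: lamp_model_def)

lemma lamp_model_group: "group lamp_model"
proof (rule groupI)
  fix x y z :: "int set \<times> int"
  show "x \<otimes>\<^bsub>lamp_model\<^esub> y \<otimes>\<^bsub>lamp_model\<^esub> z = x \<otimes>\<^bsub>lamp_model\<^esub> (y \<otimes>\<^bsub>lamp_model\<^esub> z)"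
    by (cases x; cases y; cases z) (auto simp: algebra_simps)
  show "\<one>\<^bsub>lamp_model\<^esub> \<otimes>\<^bsub>lamp_model\<^esub> x = x"
    by (cases x) auto
  obtain S p where x: "x = (S, p)" by force
  show "\<exists>y\<in>carrier lamp_model. y \<otimes>\<^bsub>lamp_model\<^esub> x = \<one>\<^bsub>lamp_model\<^esub>"
    by (intro bexI[of _ "({j. j + p \<in> S}, - p)"]) (auto simp: x)
qed auto

interpretation model: group lamp_model by (rule lamp_model_group)

lemma lamp_model_inv: "inv\<^bsub>lamp_model\<^esub> (S, p) = ({j. j + p \<in> S}, - p)"
  by (rule model.inv_equality) auto

lemma lamp_model_pow_nat: "({}, 1) [^]\<^bsub>lamp_model\<^esub> (n :: nat) = ({}, int n)"
  by (induction n) auto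

lemma lamp_model_pow: "({}, 1) [^]\<^bsub>lamp_model\<^esub> (i :: int) = ({}, i)"
  by (cases i rule: int_cases2) (simp_all add: int_pow_int lamp_model_pow_nat model.int_pow_neg_int lamp_model_inv)

text \<open>The images of \<open>t\<close> and \<open>ta\<close> when \<open>a\<close> goes to
  \<open>({0}, 0)\<close>. In \<open>ta\<close> the move comes before the toggle, hence lamp
  1.\<close>

definition model_gens :: "(int set \<times> int) set" where
  "model_gens = {({}, 1), ({1}, 1)}"

lemma sym_model_gens:
  "sym_gens lamp_model model_gens = {({}, 1), ({1}, 1), ({}, - 1), ({0}, - 1)}"
  by (auto simp: sym_gens_def model_gens_def lamp_model_inv)

section \<open>Words as walks on the integers\<close>

text \<open>Moving from \<open>p\<close> to \<open>p + 1\<close> crosses edge \<open>p + 1\<close>, moving from \<open>p\<close> to \<open>p - 1\<close> crosses edge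
  \<open>p\<close>; only the lamp on the crossed edge may change.\<close>

inductive walk :: "int set \<times> int \<Rightarrow> nat \<Rightarrow> int set \<times> int \<Rightarrow> bool" for s where
  start: "walk s 0 s"
| right: "walk s k (S, p) \<Longrightarrow> (\<And>j. j \<noteq> p + 1 \<Longrightarrow> j \<in> S' \<longleftrightarrow> j \<in> S) \<Longrightarrow> walk s (Suc k) (S', p + 1)"
| left: "walk s k (S, p) \<Longrightarrow> (\<And>j. j \<noteq> p \<Longrightarrow> j \<in> S' \<longleftrightarrow> j \<in> S) \<Longrightarrow> walk s (Suc k) (S', p - 1)"

lemma list_prod_snoc_model:
  "list_prod lamp_model (xs @ [x]) = list_prod lamp_model xs \<otimes>\<^bsub>lamp_model\<^esub> x"
  by (simp add: model.list_prod_append)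

lemma mult_list_prod_snoc_model:
  "s \<otimes>\<^bsub>lamp_model\<^esub> list_prod lamp_model (xs @ [x]) =
    s \<otimes>\<^bsub>lamp_model\<^esub> list_prod lamp_model xs \<otimes>\<^bsub>lamp_model\<^esub> x"
  by (simp add: list_prod_snoc_model model.m_assoc)

text \<open>Right multiplication of \<open>(S, p)\<close> by a letter is one step: a letter moving
  right toggles lamp \<open>p + 1\<close> or nothing, a letter moving left toggles lamp
  \<open>p\<close> or nothing.\<close>

lemma list_prod_walk:
  assumes "set xs \<subseteq> sym_gens lamp_model model_gens"
  shows "walk s (length xs) (s \<otimes>\<^bsub>lamp_model\<^esub> list_prod lamp_model xs)"
  using assms
proof (induction xs rule: rev_induct)
  case Nil
  have "s \<otimes>\<^bsub>lamp_model\<^esub> ({}, 0) = s" by (cases s) simp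
  with walk.start[of s] show ?case by (simp only: list_prod_Nil lamp_model_one list.size)
next
  case (snoc x xs)
  obtain S p where Sp: "s \<otimes>\<^bsub>lamp_model\<^esub> list_prod lamp_model xs = (S, p)" by force
  have IH: "walk s (length xs) (S, p)" using snoc Sp by simp
  have "walk s (Suc (length xs)) ((S, p) \<otimes>\<^bsub>lamp_model\<^esub> x)"
  proof -
    consider "x = ({}, 1)" | "x = ({1}, 1)" | "x = ({}, - 1)" | "x = ({0}, - 1)"
      using snoc.prems by (auto simp: sym_model_gens)
    then show ?thesis
    proof cases
      case 1
      then show ?thesis using walk.right[OF IH, of S] by simp
    next
      case 2
      then show ?thesis by (simp, intro walk.right[OF IH]) auto
    next
      case 3
      then show ?thesis using walk.left[OF IH, of S] by simp
    next
      case 4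
      have "walk s (Suc (length xs)) ({j. (j \<in> S) \<noteq> (j - p = 0)}, p - 1)"
        by (intro walk.left[OF IH]) auto
      then show ?thesis using 4 by simp
    qed
  qed
  then show ?case by (simp add: mult_list_prod_snoc_model Sp)
qed

lemma walk_list_prod:
  assumes "walk s k s'"
  shows "\<exists>xs. length xs = k \<and> set xs \<subseteq> sym_gens lamp_model model_gens \<and>
    s' = s \<otimes>\<^bsub>lamp_model\<^esub> list_prod lamp_model xs"
  using assms
proof induction
  case start
  show ?case by (cases s) simp
next
  case (right k S p S')
  then obtain xs where xs: "length xs = k" "set xs \<subseteq> sym_gens lamp_model model_gens"
    "(S, p) = s \<otimes>\<^bsub>lamp_model\<^esub> list_prod lamp_model xs" by auto
  \<comment> \<open>Of the two letters that move right, take the toggling one exactly if the lamp on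
    the crossed edge has changed.\<close>
  define x :: "int set \<times> int" where
    "x = (if (p + 1 \<in> S) = (p + 1 \<in> S') then ({}, 1) else ({1}, 1))"
  have "j \<in> S' \<longleftrightarrow> (j \<in> S) \<noteq> (j - p \<in> fst x)" for j
    using right.hyps(2)[of j] by (cases "j = p + 1") (simp_all add: x_def)
  then have "S' = {j. (j \<in> S) \<noteq> (j - p \<in> fst x)}" by blast
  moreover have "snd x = 1" by (simp add: x_def)
  ultimately have "(S', p + 1) = (S, p) \<otimes>\<^bsub>lamp_model\<^esub> (fst x, snd x)"
    unfolding lamp_model_mult by simp
  moreover have "x \<in> sym_gens lamp_model model_gens" by (simp add: x_def sym_model_gens)
  ultimately show ?case
    using xs by (intro exI[of _ "xs @ [x]"]) (auto simp: mult_list_prod_snoc_model)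
next
  case (left k S p S')
  then obtain xs where xs: "length xs = k" "set xs \<subseteq> sym_gens lamp_model model_gens"
    "(S, p) = s \<otimes>\<^bsub>lamp_model\<^esub> list_prod lamp_model xs" by auto
  define x :: "int set \<times> int" where
    "x = (if (p \<in> S) = (p \<in> S') then ({}, - 1) else ({0}, - 1))"
  have "j \<in> S' \<longleftrightarrow> (j \<in> S) \<noteq> (j - p \<in> fst x)" for j
    using left.hyps(2)[of j] by (cases "j = p") (simp_all add: x_def)
  then have "S' = {j. (j \<in> S) \<noteq> (j - p \<in> fst x)}" by blast
  moreover have "snd x = - 1" by (simp add: x_def)
  ultimately have "(S', p - 1) = (S, p) \<otimes>\<^bsub>lamp_model\<^esub> (fst x, snd x)"
    unfolding lamp_model_mult by simp
  moreover have "x \<in> sym_gens lamp_model model_gens" by (simp add: x_def sym_model_gens)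
  ultimately show ?case
    using xs by (intro exI[of _ "xs @ [x]"]) (auto simp: mult_list_prod_snoc_model)
qed

lemma walk_iff_list_prod:
  "walk s k s' \<longleftrightarrow> (\<exists>xs. length xs = k \<and> set xs \<subseteq> sym_gens lamp_model model_gens \<and>
    s' = s \<otimes>\<^bsub>lamp_model\<^esub> list_prod lamp_model xs)"
  by (rule iffI, erule walk_list_prod, elim exE conjE, hypsubst, rule list_prod_walk)

lemma word_length_eq_walk:
  "word_length lamp_model model_gens g = (LEAST k. walk ({}, 0) k g)"
proof -
  have "({}, 0) \<otimes>\<^bsub>lamp_model\<^esub> x = x" for x by (cases x) simp
  then have "walk ({}, 0) k g \<longleftrightarrow> (\<exists>xs. length xs = k \<and>
      set xs \<subseteq> sym_gens lamp_model model_gens \<and> list_prod lamp_model xs = g)" for k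
    unfolding walk_iff_list_prod eq_commute[of g] by (simp only:)
  then show ?thesis unfolding word_length_def by (simp only:)
qed

section \<open>Upper bounds: walks that set prescribed lamps\<close>

lemma walk_sweep_right:
  assumes "walk s k (S, p)" "\<And>j. j \<notin> {p<..p + int m} \<Longrightarrow> j \<in> S' \<longleftrightarrow> j \<in> S"
  shows "walk s (k + m) (S', p + int m)"
  using assms(2)
proof (induction m arbitrary: S')
  case 0
  then have "S' = S" by auto
  then show ?case using assms(1) by simp
next
  case (Suc m)
  \<comment> \<open>The configuration before the last step: the last edge is still uncrossed and
    keeps its lamp from \<open>S\<close>; all other lamps already agree with
    \<open>S'\<close>.\<close>
  define T where "T = {j. if j = p + int m + 1 then j \<in> S else j \<in> S'}"
  have "j \<in> T \<longleftrightarrow> j \<in> S" if "j \<notin> {p<..p + int m}" for j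
    using Suc.prems[of j] that by (cases "j = p + int m + 1") (auto simp: T_def)
  from Suc.IH[OF this] have "walk s (Suc (k + m)) (S', p + int m + 1)"
    by (rule walk.right) (auto simp: T_def)
  then show ?case by (simp add: ac_simps)
qed

lemma walk_sweep_left:
  assumes "walk s k (S, p)" "\<And>j. j \<notin> {p - int m<..p} \<Longrightarrow> j \<in> S' \<longleftrightarrow> j \<in> S"
  shows "walk s (k + m) (S', p - int m)"
  using assms(2)
proof (induction m arbitrary: S')
  case 0
  then have "S' = S" by auto
  then show ?case using assms(1) by simp
next
  case (Suc m)
  define T where "T = {j. if j = p - int m then j \<in> S else j \<in> S'}"
  have "j \<in> T \<longleftrightarrow> j \<in> S" if "j \<notin> {p - int m<..p}" for j
    using Suc.prems[of j] that by (cases "j = p - int m") (auto simp: T_def)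
  from Suc.IH[OF this] have "walk s (Suc (k + m)) (S', p - int m - 1)"
    by (rule walk.left) (auto simp: T_def)
  then show ?case by (simp add: algebra_simps)
qed

text \<open>The walk turns first at the end of \<open>{- n..n}\<close> on the far side of \<open>p\<close>.\<close>

lemma walk_exists:
  assumes S: "S \<subseteq> {- int n<..int n}" and p: "\<bar>p\<bar> \<le> int n"
  shows "walk ({}, 0) (4 * n - nat \<bar>p\<bar>) (S, p)"
proof (cases "p \<ge> 0")
  case True
  \<comment> \<open>Going left from 0 crosses only edges at or below 0, so the lamps above 0 wait
    for the sweep to the right.\<close>
  have "walk ({}, 0) (0 + n) (S \<inter> {..0}, 0 - int n)"
    by (rule walk_sweep_left[OF walk.start]) (use S in auto)
  then have "walk ({}, 0) (0 + n + 2 * n) (S, 0 - int n + int (2 * n))"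
    by (rule walk_sweep_right) (use S in auto)
  then have "walk ({}, 0) (3 * n) (S, int n)" by (simp add: algebra_simps)
  \<comment> \<open>The return to \<open>p\<close> changes no lamp; the total is
    \<open>n + 2 * n + (n - p)\<close>.\<close>
  then have "walk ({}, 0) (3 * n + (n - nat p)) (S, int n - int (n - nat p))"
    by (rule walk_sweep_left) simp
  then show ?thesis using True p by (simp add: of_nat_diff algebra_simps)
next
  case False
  have "walk ({}, 0) (0 + n) (S \<inter> {0<..}, 0 + int n)"
    by (rule walk_sweep_right[OF walk.start]) (use S in auto)
  then have "walk ({}, 0) (0 + n + 2 * n) (S, 0 + int n - int (2 * n))"
    by (rule walk_sweep_left) (use S in auto)
  then have "walk ({}, 0) (3 * n) (S, - int n)" by (simp add: algebra_simps)
  then have "walk ({}, 0) (3 * n + (n - nat (- p))) (S, - int n + int (n - nat (- p)))"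
    by (rule walk_sweep_right) simp
  then show ?thesis using False p by (simp add: of_nat_diff algebra_simps)
qed

section \<open>Lower bounds for the length of a walk\<close>

lemma walk_dist:
  assumes "walk (S0, p0) k g"
  shows "\<bar>snd g - p0\<bar> \<le> int k"
  using assms by induction auto

text \<open>Lamp \<open>i\<close> starts unlit, so edge \<open>i\<close> has been crossed and its
  outer end \<open>i\<close> visited. Reaching \<open>i\<close> takes \<open>i\<close> steps, and
  getting from there to \<open>snd g\<close> takes at least the distance.\<close>

lemma walk_right_lamp:
  assumes "walk ({}, 0) k g" "i \<in> fst g" "i \<ge> 1"
  shows "i + \<bar>i - snd g\<bar> \<le> int k"
  using assms(1,2)
proof induction
  case (right k S p S')
  then have "\<bar>p\<bar> \<le> int k" using walk_dist by force
  with right assms(3) show ?case by (cases "i = p + 1") auto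
next
  case (left k S p S')
  then have "\<bar>p\<bar> \<le> int k" using walk_dist by force
  with left assms(3) show ?case by (cases "i = p") auto
qed simp

text \<open>The mirror image: edge \<open>1 - m\<close> joins \<open>- m\<close> and
  \<open>1 - m\<close>, so its outer end is at distance \<open>m\<close> from 0.\<close>

lemma walk_left_lamp:
  assumes "walk ({}, 0) k g" "1 - m \<in> fst g" "m \<ge> 1"
  shows "m + \<bar>m + snd g\<bar> \<le> int k"
  using assms(1,2)
proof induction
  case (right k S p S')
  then have "\<bar>p\<bar> \<le> int k" using walk_dist by force
  with right assms(3) show ?case by (cases "1 - m = p + 1") auto
next
  case (left k S p S')
  then have "\<bar>p\<bar> \<le> int k" using walk_dist by force
  with left assms(3) show ?case by (cases "1 - m = p") auto
qed simp

text \<open>The two alternatives correspond to the end that the walk visits last.\<close>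

lemma walk_both_lamps:
  assumes "walk ({}, 0) k g" "i \<in> fst g" "1 - m \<in> fst g" "i \<ge> 1" "m \<ge> 1"
  shows "2 * i + m + \<bar>m + snd g\<bar> \<le> int k \<or> 2 * m + i + \<bar>i - snd g\<bar> \<le> int k"
  using assms(1-3)
proof induction
  case (right k S p S')
  have 1: "i + \<bar>i - p\<bar> \<le> int k" if "i \<in> S" using walk_right_lamp[OF right(1)] that assms by simp
  have 2: "m + \<bar>m + p\<bar> \<le> int k" if "1 - m \<in> S" using walk_left_lamp[OF right(1)] that assms by simp
  \<comment> \<open>Since \<open>i\<close> \<ge> 1 > \<open>1 - m\<close>, a step cannot change both
    lamps. If it crosses one of the two edges and the other lamp was lit before, the one-lamp bound
    at \<open>p\<close> suffices; otherwise both were lit before and induction applies.\<close>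
  consider "i = p + 1" "1 - m \<in> S" | "1 - m = p + 1" "i \<in> S" | "i \<in> S" "1 - m \<in> S"
    using right.prems right.hyps(2)[of i] right.hyps(2)[of "1 - m"] assms(4,5) by force
  then show ?case
  proof cases
    case 3
    then show ?thesis using right.IH by auto
  qed (use 1 2 assms(4,5) in auto)
next
  case (left k S p S')
  have 1: "i + \<bar>i - p\<bar> \<le> int k" if "i \<in> S" using walk_right_lamp[OF left(1)] that assms by simp
  have 2: "m + \<bar>m + p\<bar> \<le> int k" if "1 - m \<in> S" using walk_left_lamp[OF left(1)] that assms by simp
  consider "i = p" "1 - m \<in> S" | "1 - m = p" "i \<in> S" | "i \<in> S" "1 - m \<in> S"
    using left.prems left.hyps(2)[of i] left.hyps(2)[of "1 - m"] assms(4,5) by force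
  then show ?case
  proof cases
    case 3
    then show ?thesis using left.IH by auto
  qed (use 1 2 assms(4,5) in auto)
qed simp

text \<open>Within \<open>n\<close> steps from 0 every crossed edge joins two points of
  \<open>{- n..n}\<close>, and an edge is named by its right end; this excludes
  \<open>- n\<close>.\<close>

lemma walk_support:
  assumes "walk (S0, 0) k g" "S0 \<subseteq> {- int n<..int n}" "k \<le> n"
  shows "fst g \<subseteq> {- int n<..int n}"
  using assms(1,3)
proof induction
  case (right k S p S')
  then have "\<bar>p\<bar> \<le> int k" using walk_dist by force
  then have "p + 1 \<in> {- int n<..int n}" using right.prems by auto
  moreover have "S' \<subseteq> insert (p + 1) S" using right.hyps(2) by auto
  moreover have "S \<subseteq> {- int n<..int n}" using right.IH right.prems by simp
  ultimately show ?case by auto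
next
  case (left k S p S')
  then have "\<bar>p\<bar> \<le> int k" using walk_dist by force
  then have "p \<in> {- int n<..int n}" using left.prems by auto
  moreover have "S' \<subseteq> insert p S" using left.hyps(2) by auto
  moreover have "S \<subseteq> {- int n<..int n}" using left.IH left.prems by simp
  ultimately show ?case by auto
qed (use assms(2) in auto)

section \<open>The dead-end elements and bounds on their depth\<close>

definition lamp_dead_end :: "nat \<Rightarrow> int set \<times> int" where
  "lamp_dead_end n = ({1 - int n, int n}, 0)"

lemma walk_lamp_dead_end: "n \<ge> 1 \<Longrightarrow> walk ({}, 0) (4 * n) (lamp_dead_end n)"
  using walk_exists[of "{1 - int n, int n}" n 0] by (auto simp: lamp_dead_end_def)

lemma word_length_lamp_dead_end:
  assumes "n \<ge> 1"
  shows "word_length lamp_model model_gens (lamp_dead_end n) = 4 * n"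
  unfolding word_length_eq_walk
proof (rule Least_equality)
  \<comment> \<open>With both lamps at distance \<open>n\<close> and final position 0, each
    alternative of \<open>walk_both_lamps\<close> gives \<open>4 * n\<close>.\<close>
  show "4 * n \<le> k" if "walk ({}, 0) k (lamp_dead_end n)" for k
    using walk_both_lamps[OF that, of "int n" "int n"] assms by (auto simp: lamp_dead_end_def)
qed (rule walk_lamp_dead_end[OF assms])

lemma no_escape_lamp_dead_end:
  assumes "n \<ge> 1"
  shows "no_escape lamp_model model_gens (lamp_dead_end n) n"
  unfolding no_escape_def word_length_lamp_dead_end[OF assms]
proof (intro allI impI, elim conjE)
  fix xs
  assume xs: "length xs \<le> n" "set xs \<subseteq> sym_gens lamp_model model_gens"
  obtain S p where g: "lamp_dead_end n \<otimes>\<^bsub>lamp_model\<^esub> list_prod lamp_model xs = (S, p)" by force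
  \<comment> \<open>The word is read as a walk starting at the dead-end element. Having at most
    \<open>n\<close> steps, it ends in the range covered by \<open>walk_exists\<close>.\<close>
  have walk: "walk ({1 - int n, int n}, 0) (length xs) (S, p)"
    using list_prod_walk[OF xs(2)] g by (metis lamp_dead_end_def)
  have "S \<subseteq> {- int n<..int n}" using walk_support[OF walk _ xs(1)] assms by auto
  moreover have "\<bar>p\<bar> \<le> int n" using walk_dist[OF walk] xs(1) by auto
  ultimately have "walk ({}, 0) (4 * n - nat \<bar>p\<bar>) (S, p)" by (rule walk_exists)
  then have "(LEAST k. walk ({}, 0) k (S, p)) \<le> 4 * n - nat \<bar>p\<bar>" by (rule Least_le)
  then show "word_length lamp_model model_gens (lamp_dead_end n \<otimes>\<^bsub>lamp_model\<^esub> list_prod lamp_model xs)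
      \<le> 4 * n"
    by (simp add: g word_length_eq_walk)
qed

text \<open>Walking straight right for \<open>4 * n + 1\<close> steps ends at a position farther
  than \<open>4 * n\<close> from 0, which forces a greater length. Hence the depth is
  finite.\<close>

lemma escape_lamp_dead_end:
  assumes "n \<ge> 1"
  shows "\<not> no_escape lamp_model model_gens (lamp_dead_end n) (4 * n + 1)"
proof
  assume no: "no_escape lamp_model model_gens (lamp_dead_end n) (4 * n + 1)"
  define S where "S = {1 - int n, int n}"
  define m where "m = 4 * n + 1"
  have S: "lamp_dead_end n = (S, 0)" by (simp add: lamp_dead_end_def S_def)
  have "walk (S, 0) (0 + m) (S, 0 + int m)"
    by (rule walk_sweep_right[OF walk.start]) (rule HOL.refl)
  then obtain xs where xs: "length xs = m" "set xs \<subseteq> sym_gens lamp_model model_gens"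
    "(S, int m) = (S, 0) \<otimes>\<^bsub>lamp_model\<^esub> list_prod lamp_model xs"
    using walk_list_prod by force
  then have "word_length lamp_model model_gens (S, int m) \<le> word_length lamp_model model_gens (S, 0)"
    using no by (simp add: no_escape_def S m_def)
  also have "\<dots> = 4 * n" using word_length_lamp_dead_end[OF assms] by (simp add: S)
  finally have le: "word_length lamp_model model_gens (S, int m) \<le> 4 * n" .
  \<comment> \<open>Some walk from the identity must be exhibited so that the \<open>LEAST\<close>
    is attained; \<open>walk_dist\<close> then applies to a shortest one.\<close>
  have "walk ({}, 0) (4 * n + m) (S, 0 + int m)"
    by (rule walk_sweep_right[OF walk_lamp_dead_end[OF assms, unfolded S]]) (rule HOL.refl)
  then have "walk ({}, 0) (word_length lamp_model model_gens (S, int m)) (S, int m)"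
    unfolding word_length_eq_walk by (metis LeastI add_0)
  from walk_dist[OF this] le show False by (simp add: m_def)
qed

section \<open>Normal forms in the lamplighter group\<close>

interpretation lamplighter: group lamplighter by (rule lamplighter_is_group)

definition lamp :: "int \<Rightarrow> lamp_gen word set set" where
  "lamp i = lamp_t [^]\<^bsub>lamplighter\<^esub> i \<otimes>\<^bsub>lamplighter\<^esub> lamp_a \<otimes>\<^bsub>lamplighter\<^esub>
     lamp_t [^]\<^bsub>lamplighter\<^esub> (- i)"

lemma lamp_closed: "lamp i \<in> carrier lamplighter"
  by (simp add: lamp_def lamp_gens_closed)

text \<open>Both equations are relators pushed through the projection from the free group, which
  sends \<open>lamp_conj i\<close> to \<open>lamp i\<close>.\<close>

lemma lamp_a_square: "lamp_a \<otimes>\<^bsub>lamplighter\<^esub> lamp_a = \<one>\<^bsub>lamplighter\<^esub>"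
  and lamp_commute: "lamp i \<otimes>\<^bsub>lamplighter\<^esub> lamp j = lamp j \<otimes>\<^bsub>lamplighter\<^esub> lamp i"
proof -
  let ?p = "\<lambda>w. normal_closure free_group lamp_relators #>\<^bsub>free_group\<^esub> w"
  interpret group_hom "free_group :: lamp_gen word set monoid" lamplighter ?p
    using presented_group_proj_hom[OF lamp_relators_closed] free_group_is_group lamplighter_is_group
    by (simp add: group_hom_def group_hom_axioms_def lamplighter_def)
  have p: "?p (free_gen A) = lamp_a" "?p (free_gen T) = lamp_t"
    by (simp_all add: lamp_a_def lamp_t_def presented_gen_def)
  have trivial: "?p r = \<one>\<^bsub>lamplighter\<^esub>" if "r \<in> lamp_relators" for r
    using presented_relator_trivial[OF lamp_relators_closed that] by (simp add: lamplighter_def)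
  have "?p (free_gen A [^]\<^bsub>free_group\<^esub> (2::nat)) = \<one>\<^bsub>lamplighter\<^esub>"
    by (rule trivial) (simp add: lamp_relators_def)
  then show "lamp_a \<otimes>\<^bsub>lamplighter\<^esub> lamp_a = \<one>\<^bsub>lamplighter\<^esub>"
    by (simp add: hom_nat_pow free_gen_closed p numeral_2_eq_2 lamp_gens_closed)
  have conj: "lamp_conj i \<in> carrier free_group" for i
    by (simp add: lamp_conj_def free_gen_closed)
  have pconj: "?p (lamp_conj i) = lamp i" for i
    by (simp add: lamp_conj_def lamp_def free_gen_closed hom_int_pow p del: G.int_pow_neg)
  have "?p (group_commutator free_group (lamp_conj i) (lamp_conj j)) = \<one>\<^bsub>lamplighter\<^esub>"
    by (rule trivial) (auto simp: lamp_relators_def)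
  then have "lamp i \<otimes>\<^bsub>lamplighter\<^esub> lamp j \<otimes>\<^bsub>lamplighter\<^esub> inv\<^bsub>lamplighter\<^esub> (lamp i)
      \<otimes>\<^bsub>lamplighter\<^esub> inv\<^bsub>lamplighter\<^esub> (lamp j) = \<one>\<^bsub>lamplighter\<^esub>"
    by (simp only: group_commutator_def hom_mult hom_inv conj pconj G.m_closed G.inv_closed)
  moreover note lamp_closed[of i] lamp_closed[of j]
  ultimately show "lamp i \<otimes>\<^bsub>lamplighter\<^esub> lamp j = lamp j \<otimes>\<^bsub>lamplighter\<^esub> lamp i"
    by (metis lamplighter.inv_closed lamplighter.m_closed lamplighter.inv_solve_right'
        lamplighter.l_one lamplighter.one_closed)
qed

section \<open>The commutative subgroup generated by the lamps\<close>

lemma (in group) commutes_generate: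
  assumes S: "S \<subseteq> carrier G" and y: "y \<in> carrier G" and comm: "\<And>s. s \<in> S \<Longrightarrow> y \<otimes> s = s \<otimes> y"
    and x: "x \<in> generate G S"
  shows "y \<otimes> x = x \<otimes> y"
  using x
proof induction
  case (inv s)
  then have s: "s \<in> carrier G" using S by auto
  have "y \<otimes> inv s = inv s \<otimes> (s \<otimes> y) \<otimes> inv s" using s y by (simp add: m_assoc[symmetric])
  also have "\<dots> = inv s \<otimes> (y \<otimes> s) \<otimes> inv s" using comm[OF inv] by simp
  also have "\<dots> = inv s \<otimes> y" using s y by (simp add: m_assoc)
  finally show ?case .
next
  case (eng x1 x2)
  then have x: "x1 \<in> carrier G" "x2 \<in> carrier G" using generate_in_carrier[OF S] by auto
  have "y \<otimes> (x1 \<otimes> x2) = y \<otimes> x1 \<otimes> x2" using x y by (simp add: m_assoc)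
  also have "\<dots> = x1 \<otimes> (y \<otimes> x2)" using x y by (simp add: eng.IH(1) m_assoc)
  also have "\<dots> = x1 \<otimes> x2 \<otimes> y" using x y by (simp add: eng.IH(2) m_assoc)
  finally show ?case .
qed (simp_all add: y comm)

text \<open>\<open>commutes_generate\<close> is used twice: first to let \<open>x\<close> commute
  with all generators, then with all of the generated subgroup.\<close>

lemma (in group) generate_comm_group:
  assumes S: "S \<subseteq> carrier G" and comm: "\<And>s t. s \<in> S \<Longrightarrow> t \<in> S \<Longrightarrow> s \<otimes> t = t \<otimes> s"
  shows "comm_group (G\<lparr>carrier := generate G S\<rparr>)"
proof (rule group.group_comm_groupI)
  show "group (G\<lparr>carrier := generate G S\<rparr>)"
    by (rule subgroup.subgroup_is_group[OF generate_is_subgroup[OF S] is_group])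
  fix x y
  assume "x \<in> carrier (G\<lparr>carrier := generate G S\<rparr>)" "y \<in> carrier (G\<lparr>carrier := generate G S\<rparr>)"
  then have xy: "x \<in> generate G S" "y \<in> generate G S" by auto
  have "x \<otimes> s = s \<otimes> x" if "s \<in> S" for s
    using commutes_generate[OF S subsetD[OF S that] comm[OF that] xy(1)] by (rule HOL.sym)
  then have "x \<otimes> y = y \<otimes> x"
    by (rule commutes_generate[OF S generate_in_carrier[OF S xy(1)] _ xy(2)])
  then show "x \<otimes>\<^bsub>G\<lparr>carrier := generate G S\<rparr>\<^esub> y = y \<otimes>\<^bsub>G\<lparr>carrier := generate G S\<rparr>\<^esub> x"
    by simp
qed

text \<open>A structure of its own, so that \<open>finprod\<close>, which calls for a commutative
  monoid, can be used inside the noncommutative \<open>lamplighter\<close>.\<close>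

definition lamp_group :: "lamp_gen word set set monoid" where
  "lamp_group = lamplighter\<lparr>carrier := generate lamplighter (range lamp)\<rparr>"

lemma lamp_group_mult [simp]: "monoid.mult lamp_group = monoid.mult lamplighter"
  and lamp_group_one [simp]: "\<one>\<^bsub>lamp_group\<^esub> = \<one>\<^bsub>lamplighter\<^esub>"
  by (simp_all add: lamp_group_def)

interpretation lamps: comm_group lamp_group
  unfolding lamp_group_def
proof (rule lamplighter.generate_comm_group)
  show "s \<otimes>\<^bsub>lamplighter\<^esub> t = t \<otimes>\<^bsub>lamplighter\<^esub> s" if "s \<in> range lamp" "t \<in> range lamp" for s t
    using that by (elim rangeE, hypsubst) (rule lamp_commute)
qed (use lamp_closed in blast)

lemma lamp_in_lamp_group [simp]: "lamp i \<in> carrier lamp_group"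
  by (auto simp: lamp_group_def intro: generate.incl)

lemma lamp_group_subset: "carrier lamp_group \<subseteq> carrier lamplighter"
  using lamplighter.generate_incl[of "range lamp"] lamp_closed by (auto simp: lamp_group_def)

text \<open>On an infinite set \<open>finprod\<close> defaults to the identity, so only finite
  \<open>S\<close> give the intended element.\<close>

definition lights :: "int set \<Rightarrow> lamp_gen word set set" where
  "lights S = finprod lamp_group lamp S"

lemma lights_closed [simp]: "lights S \<in> carrier lamp_group"
  by (simp add: lights_def)

lemma lights_empty [simp]: "lights {} = \<one>\<^bsub>lamplighter\<^esub>"
  by (simp add: lights_def)

lemma lights_insert:
  "finite S \<Longrightarrow> i \<notin> S \<Longrightarrow> lights (insert i S) = lights S \<otimes>\<^bsub>lamplighter\<^esub> lamp i"
  unfolding lights_def using lamps.m_comm[of "lamp i" "finprod lamp_group lamp S"] by simp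

lemma t_pow_mult_a:
  "lamp_t [^]\<^bsub>lamplighter\<^esub> i \<otimes>\<^bsub>lamplighter\<^esub> lamp_a =
    lamp i \<otimes>\<^bsub>lamplighter\<^esub> lamp_t [^]\<^bsub>lamplighter\<^esub> (i :: int)"
  by (simp add: lamp_def lamp_gens_closed lamplighter.m_assoc lamplighter.int_pow_neg)

text \<open>Both letters of \<open>t^i a a\<close> are moved to the left of \<open>t^i\<close>, each
  becoming \<open>lamp i\<close>; then \<open>t^i\<close> is cancelled.\<close>

lemma lamp_square: "lamp i \<otimes>\<^bsub>lamplighter\<^esub> lamp i = \<one>\<^bsub>lamplighter\<^esub>"
proof -
  let ?t = "lamp_t [^]\<^bsub>lamplighter\<^esub> i"
  have "?t = ?t \<otimes>\<^bsub>lamplighter\<^esub> lamp_a \<otimes>\<^bsub>lamplighter\<^esub> lamp_a"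
    by (simp add: lamp_gens_closed lamplighter.m_assoc lamp_a_square)
  also have "\<dots> = lamp i \<otimes>\<^bsub>lamplighter\<^esub> (?t \<otimes>\<^bsub>lamplighter\<^esub> lamp_a)"
    by (simp add: t_pow_mult_a lamp_gens_closed lamp_closed lamplighter.m_assoc)
  also have "\<dots> = lamp i \<otimes>\<^bsub>lamplighter\<^esub> lamp i \<otimes>\<^bsub>lamplighter\<^esub> ?t"
    by (simp add: t_pow_mult_a lamp_gens_closed lamp_closed lamplighter.m_assoc)
  finally show ?thesis
    by (metis lamp_closed lamp_gens_closed(2) lamplighter.int_pow_closed lamplighter.l_one
        lamplighter.m_closed lamplighter.one_closed lamplighter.right_cancel)
qed

lemma lights_mult_lamp:
  assumes "finite S"
  shows "lights S \<otimes>\<^bsub>lamplighter\<^esub> lamp i = lights (sym_diff S {i})"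
proof (cases "i \<in> S")
  case True
  then have S: "sym_diff S {i} = S - {i}" "lights S = lights (S - {i}) \<otimes>\<^bsub>lamplighter\<^esub> lamp i"
    using lights_insert[of "S - {i}" i] assms by (auto simp: insert_absorb)
  have "lights (S - {i}) \<in> carrier lamplighter" using lights_closed lamp_group_subset by blast
  then show ?thesis
    unfolding S by (simp add: lamplighter.m_assoc lamp_closed lamp_square)
next
  case False
  then have "sym_diff S {i} = insert i S" by auto
  then show ?thesis using lights_insert[OF assms False] by simp
qed

section \<open>Normal forms and the embedding into the model\<close>

definition normal_form :: "int set \<Rightarrow> int \<Rightarrow> lamp_gen word set set" where
  "normal_form S p = lights S \<otimes>\<^bsub>lamplighter\<^esub> lamp_t [^]\<^bsub>lamplighter\<^esub> p"

lemma lights_carrier [simp]: "lights S \<in> carrier lamplighter"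
  using lights_closed lamp_group_subset by blast

lemma normal_form_mult_t_pow:
  "normal_form S p \<otimes>\<^bsub>lamplighter\<^esub> lamp_t [^]\<^bsub>lamplighter\<^esub> (q :: int) = normal_form S (p + q)"
  by (simp add: normal_form_def lamp_gens_closed lamplighter.m_assoc lamplighter.int_pow_mult)

lemma normal_form_mult_a:
  assumes "finite S"
  shows "normal_form S p \<otimes>\<^bsub>lamplighter\<^esub> lamp_a = normal_form (sym_diff S {p}) p"
proof -
  have "normal_form S p \<otimes>\<^bsub>lamplighter\<^esub> lamp_a =
      lights S \<otimes>\<^bsub>lamplighter\<^esub> (lamp_t [^]\<^bsub>lamplighter\<^esub> p \<otimes>\<^bsub>lamplighter\<^esub> lamp_a)"
    by (simp add: normal_form_def lamp_gens_closed lamplighter.m_assoc)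
  also have "\<dots> = lights S \<otimes>\<^bsub>lamplighter\<^esub> lamp p \<otimes>\<^bsub>lamplighter\<^esub> lamp_t [^]\<^bsub>lamplighter\<^esub> p"
    by (simp add: t_pow_mult_a lamp_gens_closed lamp_closed lamplighter.m_assoc)
  finally show ?thesis by (simp add: lights_mult_lamp[OF assms] normal_form_def)
qed

text \<open>Induction on a word in \<open>a\<close> and \<open>t\<close>, appending letters:
  \<open>a\<close> toggles the lamp at the current position, and \<open>t\<close> or its inverse
  moves the position.\<close>

lemma normal_form_exists:
  assumes "g \<in> carrier lamplighter"
  shows "\<exists>S p. finite S \<and> g = normal_form S p"
proof -
  have UNIV: "(UNIV :: lamp_gen set) = {A, T}" by (auto intro: lamp_gen.exhaust)
  have gens: "{lamp_a, lamp_t} \<subseteq> carrier lamplighter" using lamp_gens_closed by simp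
  have "generate lamplighter {lamp_a, lamp_t} = carrier lamplighter"
    using presented_group_generated[OF lamp_relators_closed]
    by (simp add: UNIV lamp_a_def lamp_t_def lamplighter_def)
  then obtain xs where xs: "set xs \<subseteq> sym_gens lamplighter {lamp_a, lamp_t}" "list_prod lamplighter xs = g"
    using lamplighter.generate_imp_list_prod[OF gens] assms by metis
  have "inv\<^bsub>lamplighter\<^esub> lamp_a = lamp_a"
    by (rule lamplighter.inv_equality[OF lamp_a_square]) (simp_all add: lamp_gens_closed)
  \<comment> \<open>\<open>t\<close> and its inverse appear as powers so that
    \<open>normal_form_mult_t_pow\<close> covers both.\<close>
  then have sym: "sym_gens lamplighter {lamp_a, lamp_t} =
      {lamp_a, lamp_t [^]\<^bsub>lamplighter\<^esub> (1 :: int), lamp_t [^]\<^bsub>lamplighter\<^esub> (- 1 :: int)}"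
    using lamp_gens_closed by (auto simp: sym_gens_def lamplighter.int_pow_neg)
  have "\<exists>S p. finite S \<and> list_prod lamplighter xs = normal_form S p"
    using xs(1)
  proof (induction xs rule: rev_induct)
    case Nil
    have "normal_form {} 0 = \<one>\<^bsub>lamplighter\<^esub>" by (simp add: normal_form_def)
    then show ?case by (metis finite.emptyI list_prod_Nil)
  next
    case (snoc x xs)
    then obtain S p where S: "finite S" "list_prod lamplighter xs = normal_form S p" by auto
    have "set xs \<subseteq> carrier lamplighter" "x \<in> carrier lamplighter"
      using snoc.prems lamplighter.sym_gens_closed[OF gens] by auto
    then have "list_prod lamplighter (xs @ [x]) = normal_form S p \<otimes>\<^bsub>lamplighter\<^esub> x"
      by (simp add: lamplighter.list_prod_append S)
    moreover have "x \<in> {lamp_a, lamp_t [^]\<^bsub>lamplighter\<^esub> (1 :: int), lamp_t [^]\<^bsub>lamplighter\<^esub> (- 1 :: int)}"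
      using snoc.prems unfolding sym by simp
    moreover have "finite (sym_diff S {p})" using S(1) by simp
    ultimately show ?case
      using S(1) normal_form_mult_a[OF S(1), of p] normal_form_mult_t_pow[of S p] by (metis insertE singletonD)
  qed
  with xs(2) show ?thesis by simp
qed

text \<open>The universal property supplies \<open>h\<close>. It sends
  \<open>normal_form S p\<close> to \<open>(S, p)\<close>, so an image determines the normal form of
  its preimage; with the existence of normal forms this is injectivity.\<close>

lemma lamplighter_embedding:
  "\<exists>h\<in>hom lamplighter lamp_model. inj_on h (carrier lamplighter) \<and>
    h lamp_t = ({}, 1) \<and> h lamp_a = ({0}, 0)"
proof -
  define f :: "lamp_gen \<Rightarrow> int set \<times> int" where "f x = (case x of A \<Rightarrow> ({0}, 0) | T \<Rightarrow> ({}, 1))" for x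
  have conj: "({}, i) \<otimes>\<^bsub>lamp_model\<^esub> ({0}, 0) \<otimes>\<^bsub>lamp_model\<^esub> ({}, - i) = ({i}, 0)" for i
    by auto
  have relators: "h r = \<one>\<^bsub>lamp_model\<^esub>"
    if h: "h \<in> hom free_group lamp_model" "\<And>x. h (free_gen x) = f x" and r: "r \<in> lamp_relators" for h r
  proof -
    interpret group_hom "free_group :: lamp_gen word set monoid" lamp_model h
      using h(1) lamp_model_group free_group_is_group by (simp add: group_hom_def group_hom_axioms_def)
    have closed: "lamp_conj i \<in> carrier free_group" for i
      by (simp add: lamp_conj_def free_gen_closed)
    have h_conj: "h (lamp_conj i) = ({i}, 0)" for i
      by (simp add: lamp_conj_def free_gen_closed hom_int_pow h(2) f_def lamp_model_pow conj
          del: G.int_pow_neg lamp_model_mult)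
    consider "r = free_gen A [^]\<^bsub>free_group\<^esub> (2::nat)"
      | i j where "r = group_commutator free_group (lamp_conj i) (lamp_conj j)"
      using r by (auto simp: lamp_relators_def)
    then show ?thesis
    proof cases
      case 1
      then show ?thesis
        by (simp add: hom_nat_pow free_gen_closed h(2) f_def numeral_2_eq_2)
    next
      case 2
      then show ?thesis
        by (auto simp: group_commutator_def closed h_conj lamp_model_inv)
    qed
  qed
  have "\<exists>h\<in>hom lamplighter lamp_model. \<forall>x. h (presented_gen lamp_relators x) = f x"
    unfolding lamplighter_def
    by (rule presented_group_lift[OF lamp_model_group _ lamp_relators_closed])
      (simp, rule relators)
  then obtain h where h: "h \<in> hom lamplighter lamp_model" "\<And>x. h (presented_gen lamp_relators x) = f x"
    by blast
  interpret group_hom lamplighter lamp_model h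
    using h(1) lamp_model_group lamplighter_is_group by (simp add: group_hom_def group_hom_axioms_def)
  have gens: "h lamp_t = ({}, 1)" "h lamp_a = ({0}, 0)"
    using h(2) by (simp_all add: lamp_t_def lamp_a_def f_def)
  have pow: "h (lamp_t [^]\<^bsub>lamplighter\<^esub> i) = ({}, i)" for i :: int
    by (simp add: hom_int_pow lamp_gens_closed gens lamp_model_pow)
  have lamp: "h (lamp i) = ({i}, 0)" for i
    by (simp add: lamp_def lamp_gens_closed gens pow conj del: lamplighter.int_pow_neg lamp_model_mult)
  have lights: "h (lights S) = (S, 0)" if "finite S" for S
    using that
  proof induction
    case (insert i S)
    then show ?case by (auto simp: lights_insert lamp_closed lamp)
  qed simp
  have "h (normal_form S p) = (S, p)" if "finite S" for S p
    using that by (simp add: normal_form_def lamp_gens_closed lights pow)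
  then have "inj_on h (carrier lamplighter)"
    by (intro inj_onI) (metis normal_form_exists prod.inject)
  with h(1) gens show ?thesis by blast
qed

section \<open>Pulling the dead ends back to the lamplighter group\<close>

theorem theorem3p3:
  fixes N :: nat
  assumes "N \<ge> 1"
  shows "\<exists>w\<in>carrier lamplighter.
    dead_end lamplighter {lamp_t, lamp_t \<otimes>\<^bsub>lamplighter\<^esub> lamp_a} w \<and>
    (\<exists>k\<ge>N. has_depth lamplighter {lamp_t, lamp_t \<otimes>\<^bsub>lamplighter\<^esub> lamp_a} w k)"
proof -
  let ?X = "{lamp_t, lamp_t \<otimes>\<^bsub>lamplighter\<^esub> lamp_a}"
  obtain h where h: "h \<in> hom lamplighter lamp_model" and inj: "inj_on h (carrier lamplighter)"
    and gens: "h lamp_t = ({}, 1)" "h lamp_a = ({0}, 0)"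
    using lamplighter_embedding by blast
  interpret group_hom lamplighter lamp_model h
    using h lamp_model_group lamplighter_is_group by (simp add: group_hom_def group_hom_axioms_def)
  have X: "?X \<subseteq> carrier lamplighter" using lamp_gens_closed by simp
  have image: "h ` ?X = model_gens"
    using gens by (auto simp: model_gens_def lamp_gens_closed)
  \<comment> \<open>The model has elements outside the image of \<open>h\<close>, so a preimage of
    \<open>lamp_dead_end N\<close> has to be found: the walk that reaches it is a word in the images
    of the generators and lifts letter by letter.\<close>
  obtain ys where ys: "set ys \<subseteq> h ` sym_gens lamplighter ?X"
    "lamp_dead_end N = \<one>\<^bsub>lamp_model\<^esub> \<otimes>\<^bsub>lamp_model\<^esub> list_prod lamp_model ys"
    using walk_list_prod[OF walk_lamp_dead_end[OF assms]] unfolding sym_gens_image[OF X, symmetric] image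
    by auto
  from ys(1) have "ys \<in> lists (h ` sym_gens lamplighter ?X)" by (simp only: lists_eq_set mem_Collect_eq)
  then obtain xs where xs: "set xs \<subseteq> sym_gens lamplighter ?X" "ys = map h xs"
    unfolding lists_image by (auto simp: lists_eq_set)
  define w where "w = list_prod lamplighter xs"
  have "set xs \<subseteq> carrier lamplighter" using xs(1) lamplighter.sym_gens_closed[OF X] by blast
  then have w: "w \<in> carrier lamplighter" and hw: "h w = lamp_dead_end N"
    using ys(2) by (simp_all add: w_def hom_list_prod xs(2) model.l_one del: lamp_model_one)
  have "no_escape lamplighter ?X w k \<longleftrightarrow> no_escape lamp_model model_gens (lamp_dead_end N) k" for k
    using no_escape_inj_hom[OF inj X w] by (simp only: image hw)
  then have no: "no_escape lamplighter ?X w N" and esc: "\<not> no_escape lamplighter ?X w (4 * N + 1)"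
    using no_escape_lamp_dead_end[OF assms] escape_lamp_dead_end[OF assms] by simp_all
  show ?thesis
    by (intro bexI[OF _ w] conjI has_depth_ge[OF no esc]
        no_escape_imp_dead_end[OF lamplighter_is_group X w no assms])
qed

end
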